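(* Let $a,b,c>0$ be real numbers with $c\le a+b$, let $p\in\mathbb{R}$, and let $\mathcal{G}_p(x)=(1-x)^p\exp\left(F(a,b;c;x)\right)$ for $x\in(0,1)$. Then: (i) $\mathcal{G}_p$ and $\mathcal{G}_p'$ are both absolutely monotonic on $(0,1)$ if and only if $p\le\frac{ab}{c}$. (ii) If $c=a+b$ and $a+b\ge 2ab(a+b+1)$, then $-\mathcal{G}_p'$ is absolutely monotonic on $(0,1)$ whenever $\frac{ab(2a+2b+1)}{(a+b)(a+b+1)}\le p\le 1$.
   Context: $F(a,b;c;x)=\sum_{n=0}^\infty\frac{(a)_n(b)_n}{(c)_n}\frac{x^n}{n!}$ is the Gaussian hypergeometric function, with $(a)_0=1$ and $(a)_n=a(a+1)\cdots(a+n-1)$ for $n\ge1$. A function $f$ is absolutely monotonic on an interval $I$ if all derivatives $f^{(k)}$ exist on $I$ and $f^{(k)}(x)\ge0$ for all $x\in I$ and all integers $k\ge0$. *)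

theory Defs
  imports "HOL-Analysis.Analysis"
begin

definition gauss_hypergeo :: "real \<Rightarrow> real \<Rightarrow> real \<Rightarrow> real \<Rightarrow> real" where
  "gauss_hypergeo a b c x =
     (\<Sum>n. (pochhammer a n * pochhammer b n / pochhammer c n) * (x ^ n / fact n))"

lemma gauss_hypergeo_eq_eval_fps:
  "gauss_hypergeo a b c x = eval_fps (fps_hypergeo [a, b] [c] 1) x"
  by (simp add: gauss_hypergeo_def eval_fps_def)

(* D k plays the role of the k-th derivative of f on I. Differentiation is relative to I, so
   it is one-sided at an endpoint belonging to I and the ordinary one when I is open; on a
   nondegenerate interval the values D k x, for x in I, are uniquely determined by f. *)
definition absolutely_monotonic_on :: "real set \<Rightarrow> (real \<Rightarrow> real) \<Rightarrow> bool" where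
  "absolutely_monotonic_on I f \<longleftrightarrow>
     (\<exists>D :: nat \<Rightarrow> real \<Rightarrow> real.
        (\<forall>x\<in>I. D 0 x = f x) \<and>
        (\<forall>k. \<forall>x\<in>I. (D k has_real_derivative D (Suc k) x) (at x within I)) \<and>
        (\<forall>k. \<forall>x\<in>I. D k x \<ge> 0))"

(* Only the values on 0 < x < 1 matter; there the base of powr is positive. *)
definition G_fun :: "real \<Rightarrow> real \<Rightarrow> real \<Rightarrow> real \<Rightarrow> real \<Rightarrow> real" where
  "G_fun a b c p x = (1 - x) powr p * exp (gauss_hypergeo a b c x)"

end

theory Submission
  imports Defs "HOL-Real_Asymp.Real_Asymp"
begin

text \<open>
  Write \<open>F\<close> for the hypergeometric series, \<open>G\<close> for \<open>(1 - x)\<^sup>p exp (F x)\<close>, and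
  \<open>F' = \<Sum> g\<^sub>n x\<^sup>n\<close>.  The logarithmic derivative of \<open>G\<close> is
  \<open>F' - p / (1 - x) = \<Sum> (g\<^sub>n - p) x\<^sup>n\<close>.  For \<open>c \<le> a + b\<close> the sequence \<open>g\<close> increases from
  \<open>g\<^sub>0 = a b / c\<close>, so \<open>p \<le> a b / c\<close> makes all its coefficients nonnegative, and a
  nonnegative function whose logarithmic derivative is absolutely monotonic is itself
  absolutely monotonic.  Conversely, \<open>G' \<ge> 0\<close> near \<open>0\<close> forces the value \<open>g\<^sub>0 - p\<close> of the
  logarithmic derivative at \<open>0\<close> to be nonnegative.

  For the second part, \<open>G\<close> is, up to the factor \<open>e\<close>, the \<open>p\<close>-th power of
  \<open>V = (1 - x) W\<close> with \<open>W = exp ((F - 1) / p) = \<Sum> w\<^sub>n x\<^sup>n\<close>.  If \<open>-V'\<close> is absolutely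
  monotonic, then so are \<open>1 / V\<close> and, for \<open>p \<le> 1\<close>, the power \<open>V\<^bsup>p - 1\<^esup>\<close>, and hence
  \<open>-(V\<^sup>p)' = p (-V') V\<^bsup>p - 1\<^esup>\<close>.  The coefficients of \<open>V\<close> are the differences of \<open>w\<close>, so it
  all comes down to \<open>w\<close> being decreasing (\<open>exp_coeff_nonneg_antimono\<close>).

  This is an induction.  For \<open>c = a + b\<close> one has
  \<open>g\<^bsub>k+1\<^esub> = g\<^sub>k (1 + a b e\<^sub>k)\<close> with \<open>e\<^sub>k = 1 / ((k + 1) (k + 1 + c))\<close>.  Inserting this into
  \<open>(n + 1) w\<^bsub>n+1\<^esub> = \<theta> \<Sum>\<^bsub>k\<le>n\<^esub> g\<^sub>k w\<^bsub>n-k\<^esub>\<close>, where \<open>\<theta> = 1 / p\<close>, and subtracting the same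
  recurrence for \<open>n w\<^sub>n\<close> gives
  \<open>(n + 1) w\<^bsub>n+1\<^esub> = (n + \<theta> g\<^sub>0) w\<^sub>n + \<theta> a b \<Sum>\<^bsub>k<n\<^esub> t\<^sub>k e\<^sub>k\<close> with \<open>t\<^sub>k = g\<^sub>k w\<^bsub>n-1-k\<^esub>\<close>.  By the
  induction hypothesis \<open>t\<close> is increasing, whereas \<open>e\<close> is decreasing, so Chebyshev's sum
  inequality replaces the \<open>t\<^sub>k\<close> by their mean \<open>w\<^sub>n / \<theta>\<close>.  It remains to see that
  \<open>\<theta> g\<^sub>0 + a b \<Sum> e\<^sub>k \<le> 1\<close>, which follows from the bounds on \<open>p\<close> and \<open>a b\<close>.
\<close>

section \<open>Absolutely monotonic functions\<close>

text \<open>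
  Absolute monotonicity is the greatest property of functions that implies nonnegativity and
  passes from a function to a derivative.  Proofs thus only need a class of nonnegative
  functions in which every member has a derivative, and no formulas for higher derivatives.
\<close>
lemma absolutely_monotonic_on_coinduct:
  assumes f: "C f"
    and nonneg: "\<And>h x. C h \<Longrightarrow> x \<in> I \<Longrightarrow> h x \<ge> 0"
    and step: "\<And>h. C h \<Longrightarrow>
      \<exists>h'. C h' \<and> (\<forall>x\<in>I. (h has_real_derivative h' x) (at x within I))"
  shows "absolutely_monotonic_on I f"
proof -
  obtain d where d: "\<And>h. C h \<Longrightarrow>
      C (d h) \<and> (\<forall>x\<in>I. (h has_real_derivative d h x) (at x within I))"
    using step by metis
  have C: "C ((d ^^ k) f)" for k
    by (induction k) (auto simp: f d)
  show ?thesis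
    unfolding absolutely_monotonic_on_def
  proof (intro exI[of _ "\<lambda>k. (d ^^ k) f"] conjI allI ballI)
    fix k x assume "x \<in> I"
    then show "((d ^^ k) f has_real_derivative (d ^^ Suc k) f x) (at x within I)"
      and "(d ^^ k) f x \<ge> 0"
      using C[of k] d nonneg by auto
  qed simp
qed

lemma absolutely_monotonic_on_nonneg:
  "absolutely_monotonic_on I f \<Longrightarrow> x \<in> I \<Longrightarrow> f x \<ge> 0"
  unfolding absolutely_monotonic_on_def by metis

lemma absolutely_monotonic_on_cong:
  "absolutely_monotonic_on I f \<Longrightarrow> (\<And>x. x \<in> I \<Longrightarrow> f x = h x) \<Longrightarrow>
   absolutely_monotonic_on I h"
  unfolding absolutely_monotonic_on_def by metis

lemma absolutely_monotonic_on_derivative: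
  assumes "absolutely_monotonic_on I f"
  obtains f' where "absolutely_monotonic_on I f'"
    "\<forall>x\<in>I. (f has_real_derivative f' x) (at x within I)"
proof -
  obtain D where D: "\<forall>x\<in>I. D 0 x = f x"
    "\<forall>k. \<forall>x\<in>I. (D k has_real_derivative D (Suc k) x) (at x within I)"
    "\<forall>k. \<forall>x\<in>I. D k x \<ge> (0::real)"
    using assms unfolding absolutely_monotonic_on_def by auto
  show thesis
  proof
    show "absolutely_monotonic_on I (D 1)"
      unfolding absolutely_monotonic_on_def
      by (rule exI[of _ "\<lambda>k. D (Suc k)"]) (use D in auto)
    show "\<forall>x\<in>I. (f has_real_derivative D 1 x) (at x within I)"
      using D(1,2) unfolding has_field_derivative_def
      by (auto intro!: has_derivative_transform[of _ I f "D 0"])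
  qed
qed

lemma absolutely_monotonic_on_const:
  "c \<ge> 0 \<Longrightarrow> absolutely_monotonic_on I (\<lambda>_. c)"
  by (rule absolutely_monotonic_on_coinduct[of "\<lambda>h. \<exists>c\<ge>0. h = (\<lambda>_. c)"])
     (auto intro!: exI[of _ "\<lambda>_. 0"])

text \<open>
  The semiring generated by \<open>y\<close> over the absolutely monotonic functions.  It is closed under
  differentiation as soon as it contains \<open>y'\<close>, so it can serve as the class in a coinduction
  about a solution of a differential equation \<open>y' = P(x, y)\<close> with \<open>P\<close> a polynomial in \<open>y\<close>.
\<close>
inductive am_semiring :: "real set \<Rightarrow> (real \<Rightarrow> real) \<Rightarrow> (real \<Rightarrow> real) \<Rightarrow> bool"
  for I y where
  gen: "am_semiring I y y"
| am: "absolutely_monotonic_on I f \<Longrightarrow> am_semiring I y f"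
| add: "am_semiring I y f \<Longrightarrow> am_semiring I y h \<Longrightarrow> am_semiring I y (\<lambda>x. f x + h x)"
| mult: "am_semiring I y f \<Longrightarrow> am_semiring I y h \<Longrightarrow> am_semiring I y (\<lambda>x. f x * h x)"

lemma absolutely_monotonic_on_ode:
  assumes y: "\<And>x. x \<in> I \<Longrightarrow> y x \<ge> 0"
    and y': "am_semiring I y y'"
      "\<And>x. x \<in> I \<Longrightarrow> (y has_real_derivative y' x) (at x within I)"
    and f: "am_semiring I y f"
  shows "absolutely_monotonic_on I f"
  using f
proof (rule absolutely_monotonic_on_coinduct[of "am_semiring I y"])
  fix h x assume "am_semiring I y h" "x \<in> I"
  then show "h x \<ge> 0"
    by (induction rule: am_semiring.induct) (auto simp: y absolutely_monotonic_on_nonneg)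
next
  fix h assume "am_semiring I y h"
  then show "\<exists>h'. am_semiring I y h' \<and>
      (\<forall>x\<in>I. (h has_real_derivative h' x) (at x within I))"
  proof induction
    case gen
    then show ?case using y' by auto
  next
    case (am f)
    then show ?case
      by (meson absolutely_monotonic_on_derivative am_semiring.am)
  next
    case (add f h)
    then obtain f' h' where "am_semiring I y f'" "am_semiring I y h'"
      "\<forall>x\<in>I. (f has_real_derivative f' x) (at x within I)"
      "\<forall>x\<in>I. (h has_real_derivative h' x) (at x within I)" by blast
    then show ?case
      by (intro exI[of _ "\<lambda>x. f' x + h' x"])
         (auto intro!: am_semiring.add DERIV_add)
  next
    case (mult f h)
    then obtain f' h' where "am_semiring I y f'" "am_semiring I y h'"
      "\<forall>x\<in>I. (f has_real_derivative f' x) (at x within I)"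
      "\<forall>x\<in>I. (h has_real_derivative h' x) (at x within I)" by blast
    with mult.hyps show ?case
      by (intro exI[of _ "\<lambda>x. f' x * h x + h' x * f x"])
         (auto intro!: am_semiring.add am_semiring.mult DERIV_mult)
  qed
qed

text \<open>With \<open>y = 0\<close>, the differential equation is trivial and only the product rule is left.\<close>
lemma absolutely_monotonic_on_mult:
  assumes "absolutely_monotonic_on I f" "absolutely_monotonic_on I h"
  shows "absolutely_monotonic_on I (\<lambda>x. f x * h x)"
proof (rule absolutely_monotonic_on_ode[of I "\<lambda>_. 0" "\<lambda>_. 0"])
  show "am_semiring I (\<lambda>_. 0) (\<lambda>x. f x * h x)"
    using assms by (intro am_semiring.mult am_semiring.am)
qed (simp_all add: am_semiring.gen)

text \<open>The linear equation \<open>y' = g y\<close>; it takes the place of exponentials of power series.\<close>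
lemma absolutely_monotonic_on_log_derivative:
  assumes "absolutely_monotonic_on I g" "\<And>x. x \<in> I \<Longrightarrow> y x \<ge> 0"
    and "\<And>x. x \<in> I \<Longrightarrow> (y has_real_derivative g x * y x) (at x within I)"
  shows "absolutely_monotonic_on I y"
proof (rule absolutely_monotonic_on_ode[of I y "\<lambda>x. g x * y x"])
  show "am_semiring I y (\<lambda>x. g x * y x)"
    using assms(1) by (intro am_semiring.mult am_semiring.gen am_semiring.am)
qed (simp_all add: am_semiring.gen assms)

text \<open>Here \<open>y = 1 / H\<close> solves the quadratic equation \<open>y' = K y\<^sup>2\<close>.\<close>
lemma absolutely_monotonic_on_inverse:
  assumes "absolutely_monotonic_on I K" "\<And>x. x \<in> I \<Longrightarrow> H x > 0"
    and "\<And>x. x \<in> I \<Longrightarrow> (H has_real_derivative - K x) (at x within I)"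
  shows "absolutely_monotonic_on I (\<lambda>x. inverse (H x))"
proof (rule absolutely_monotonic_on_ode)
  let ?y = "\<lambda>x. inverse (H x)"
  show "am_semiring I ?y (\<lambda>x. K x * (?y x * ?y x))"
    by (intro am_semiring.mult am_semiring.gen am_semiring.am assms)
  show "(?y has_real_derivative K x * (?y x * ?y x)) (at x within I)" if "x \<in> I" for x
    using DERIV_inverse'[OF assms(3)[OF that]] assms(2)[OF that] by (simp add: mult_ac)
  show "am_semiring I ?y ?y" by (rule am_semiring.gen)
qed (use assms(2) in \<open>auto simp: less_imp_le\<close>)

text \<open>
  The function in the conclusion is \<open>-(H\<^sup>p)'\<close>.  Its last factor has the logarithmic derivative
  \<open>(1 - p) K / H\<close>, and this is where \<open>p \<le> 1\<close> enters.
\<close>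
lemma absolutely_monotonic_on_neg_derivative_powr:
  assumes K: "absolutely_monotonic_on I K" and H: "\<And>x. x \<in> I \<Longrightarrow> H x > 0"
    and H': "\<And>x. x \<in> I \<Longrightarrow> (H has_real_derivative - K x) (at x within I)"
    and p: "0 \<le> p" "p \<le> 1"
  shows "absolutely_monotonic_on I (\<lambda>x. p * K x * H x powr (p - 1))"
proof -
  have inv: "absolutely_monotonic_on I (\<lambda>x. inverse (H x))"
    using K H H' by (rule absolutely_monotonic_on_inverse)
  have const: "absolutely_monotonic_on I (\<lambda>_. 1 - p)" "absolutely_monotonic_on I (\<lambda>_. p)"
    using p by (simp_all add: absolutely_monotonic_on_const)
  have "absolutely_monotonic_on I (\<lambda>x. H x powr (p - 1))"
  proof (rule absolutely_monotonic_on_log_derivative)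
    show "absolutely_monotonic_on I (\<lambda>x. (1 - p) * (K x * inverse (H x)))"
      by (rule absolutely_monotonic_on_mult[OF const(1) absolutely_monotonic_on_mult[OF K inv]])
    show "((\<lambda>x. H x powr (p - 1)) has_real_derivative
        (1 - p) * (K x * inverse (H x)) * H x powr (p - 1)) (at x within I)" if "x \<in> I" for x
      using DERIV_chain2[OF has_real_derivative_powr[OF H[OF that], of "p - 1"] H'[OF that]]
        H[OF that] by (simp add: powr_diff field_simps power2_eq_square)
  qed auto
  then show ?thesis
    by (rule absolutely_monotonic_on_mult[OF absolutely_monotonic_on_mult[OF const(2) K]])
qed

section \<open>Power series\<close>

lemma fps_conv_radius_ge_1I:
  fixes f :: "real fps"
  assumes "\<And>n. \<bar>fps_nth f n\<bar> \<le> B"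
  shows "fps_conv_radius f \<ge> 1"
  unfolding fps_conv_radius_def
proof (rule conv_radius_geI_ex')
  fix r :: real assume r: "0 < r" "ereal r < 1"
  then have "r < 1" by (simp add: one_ereal_def)
  with r have "summable (\<lambda>n. B * r ^ n)"
    by (intro summable_mult summable_geometric) simp
  moreover have "norm (fps_nth f n * of_real r ^ n) \<le> B * r ^ n" for n
    using assms[of n] r by (simp add: abs_mult power_abs mult_right_mono)
  ultimately show "summable (\<lambda>n. fps_nth f n * of_real r ^ n)"
    by (rule summable_comparison_test')
qed

lemma less_fps_conv_radius:
  fixes f :: "real fps" and x :: real
  assumes "fps_conv_radius f \<ge> 1" "\<bar>x\<bar> < 1"
  shows "ereal (norm x) < fps_conv_radius f"
proof -
  have "ereal (norm x) < 1" using assms(2) by (simp add: one_ereal_def)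
  then show ?thesis using assms(1) by (rule less_le_trans)
qed

text \<open>
  Every series below converges on the whole unit disc, so convergence is tracked only in the
  form of a radius at least \<open>1\<close>.
\<close>
lemma fps_conv_radius_ge_1_arith:
  fixes f h :: "real fps"
  assumes f: "fps_conv_radius f \<ge> 1" and h: "fps_conv_radius h \<ge> 1"
  shows "fps_conv_radius (f * h) \<ge> 1" "fps_conv_radius (f - h) \<ge> 1"
    and "\<bar>x\<bar> < 1 \<Longrightarrow> eval_fps (f * h) x = eval_fps f x * eval_fps h x"
    and "\<bar>x\<bar> < 1 \<Longrightarrow> eval_fps (f - h) x = eval_fps f x - eval_fps h x"
proof -
  have "1 \<le> min (fps_conv_radius f) (fps_conv_radius h)" using f h by simp
  then show "fps_conv_radius (f * h) \<ge> 1" "fps_conv_radius (f - h) \<ge> 1"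
    using fps_conv_radius_mult fps_conv_radius_diff by (blast intro: order_trans)+
qed (simp_all only: eval_fps_mult eval_fps_diff less_fps_conv_radius f h)

lemma absolutely_monotonic_on_eval_fps:
  fixes f :: "real fps"
  assumes "fps_conv_radius f \<ge> 1" and "\<And>n. fps_nth f n \<ge> 0"
  shows "absolutely_monotonic_on {0<..<1} (eval_fps f)"
proof -
  define C where "C h \<longleftrightarrow> (\<exists>u :: real fps. h = eval_fps u \<and> fps_conv_radius u \<ge> 1 \<and>
      (\<forall>n. fps_nth u n \<ge> 0))" for h
  show ?thesis
  proof (rule absolutely_monotonic_on_coinduct[of C])
    show "C (eval_fps f)" using assms by (auto simp: C_def)
  next
    fix h and x :: real assume "C h" "x \<in> {0<..<1}"
    then show "h x \<ge> 0"
      unfolding C_def eval_fps_def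
      by (auto intro!: suminf_nonneg summable_fps less_fps_conv_radius)
  next
    fix h assume "C h"
    then obtain u :: "real fps" where u: "h = eval_fps u" "fps_conv_radius u \<ge> 1"
      "\<And>n. fps_nth u n \<ge> 0" by (auto simp: C_def)
    have "C (eval_fps (fps_deriv u))"
      using u order_trans[OF u(2) fps_conv_radius_deriv] by (auto simp: C_def)
    then show "\<exists>h'. C h' \<and>
        (\<forall>x\<in>{0<..<1}. (h has_real_derivative h' x) (at x within {0<..<1}))"
      using u by (auto intro!: has_field_derivative_eval_fps less_fps_conv_radius)
  qed
qed

lemma eval_fps_geometric:
  fixes x :: real
  assumes "\<bar>x\<bar> < 1"
  shows "eval_fps (Abs_fps (\<lambda>_. q)) x = q / (1 - x)"
  using suminf_geometric[of x] suminf_mult[of "\<lambda>n. x ^ n" q] summable_geometric[of x] assms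
  by (simp add: eval_fps_def)

text \<open>
  A formal solution of \<open>W' = \<theta> F' W\<close> that converges is the exponential function it should be:
  its quotient by that exponential has derivative \<open>0\<close>.
\<close>
lemma eval_fps_exp_solution:
  fixes W F :: "real fps"
  assumes W: "fps_deriv W = fps_const \<theta> * fps_deriv F * W" "fps_nth W 0 = 1"
    and rW: "fps_conv_radius W \<ge> 1" and rF: "fps_conv_radius F \<ge> 1"
    and x: "\<bar>x\<bar> < 1"
  shows "eval_fps W x = exp (\<theta> * (eval_fps F x - fps_nth F 0))"
proof -
  define e where "e z = exp (- \<theta> * (eval_fps F z - fps_nth F 0))" for z
  have rF': "fps_conv_radius (fps_deriv F) \<ge> 1"
    using order_trans[OF rF fps_conv_radius_deriv] .
  have "((\<lambda>z. eval_fps W z * e z) has_real_derivative 0) (at z)"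
    if z: "z \<in> {-1<..<1}" for z
  proof -
    have z: "\<bar>z\<bar> < 1" using z by auto
    have "eval_fps (fps_deriv W) z = \<theta> * eval_fps (fps_deriv F) z * eval_fps W z"
      using z rF' rW by (simp add: W(1) fps_conv_radius_ge_1_arith)
    then show ?thesis
      unfolding e_def
      by (auto intro!: derivative_eq_intros has_field_derivative_eval_fps
          less_fps_conv_radius rF rW z)
  qed
  then have "(\<lambda>z. eval_fps W z * e z) constant_on {-1<..<1}"
    by (rule has_field_derivative_0_imp_constant_on) simp_all
  then have "eval_fps W x * e x = eval_fps W 0 * e 0"
    using x by (auto simp: constant_on_def abs_less_iff)
  also have "\<dots> = 1" by (simp add: e_def eval_fps_at_0 W)
  finally show ?thesis by (simp only: e_def mult_minus_left exp_minus) (simp add: divide_simps)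
qed

section \<open>Coefficients of the hypergeometric series and of its exponential\<close>

definition hypergeo_fps :: "real \<Rightarrow> real \<Rightarrow> real \<Rightarrow> real fps" where
  "hypergeo_fps a b c = Abs_fps (\<lambda>n. pochhammer a n * pochhammer b n / (pochhammer c n * fact n))"

lemma eval_hypergeo_fps: "eval_fps (hypergeo_fps a b c) x = gauss_hypergeo a b c x"
  by (simp add: eval_fps_def hypergeo_fps_def gauss_hypergeo_def)

text \<open>
  Beyond the first term, comparison with \<open>1 / (k\<^sup>2 - 1/4)\<close>, which telescopes, bounds the sum by
  \<open>1 / (1 + c) + 2 / 3\<close>.  The bound claimed exceeds this for every \<open>c\<close>, and it has the form in
  which it cancels against the bound on \<open>\<theta> g\<^sub>0\<close> in the next lemma.
\<close>
lemma sum_inverse_quadratic_le: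
  fixes c :: real
  assumes "c > 0"
  shows "(\<Sum>k=0..<n. 1 / ((real k + 1) * (real k + 1 + c))) \<le> 2 * (c + 1) / (2 * c + 1)"
proof -
  have "(\<Sum>k=0..<Suc m. 1 / ((real k + 1) * (real k + 1 + c)))
      \<le> 1 / (1 + c) + 2 / 3 - 1 / (real m + 3 / 2)" for m
  proof (induction m)
    case 0
    then show ?case by simp
  next
    case (Suc m)
    have "1 / ((real m + 2) * (real m + 2 + c)) \<le> 1 / ((real m + 3 / 2) * (real m + 5 / 2))"
      using assms by (intro divide_left_mono mult_pos_pos) (auto simp: algebra_simps)
    also have "\<dots> = 1 / (real m + 3 / 2) - 1 / (real m + 5 / 2)"
      by (simp add: field_simps)
    finally show ?case using Suc by (simp add: add_ac)
  qed
  note bound = this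
  have "(\<Sum>k=0..<n. 1 / ((real k + 1) * (real k + 1 + c))) \<le> 1 / (1 + c) + 2 / 3"
  proof (cases n)
    case (Suc m)
    have "1 / (real m + 3 / 2) \<ge> 0" by simp
    with bound[of m] show ?thesis unfolding Suc by linarith
  qed (use assms in auto)
  also have "\<dots> \<le> 2 * (c + 1) / (2 * c + 1)"
    using assms by (simp add: field_simps)
  finally show ?thesis .
qed

text \<open>
  The recurrences say that \<open>w\<close> are the coefficients of \<open>exp (\<theta> \<Sum> g\<^sub>k x\<^bsup>k+1\<^esup> / (k + 1))\<close>, and
  that \<open>g\<close> grows like the coefficients of \<open>F'\<close> for \<open>c = a + b\<close>, with \<open>g 0 * c\<close> in the role of
  \<open>a b\<close>.  The step from \<open>w\<^sub>n\<close> to \<open>w\<^bsub>n+1\<^esub>\<close> uses that \<open>w\<close> has been decreasing so far: only then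
  are \<open>t\<close> and \<open>e\<close> oppositely ordered, as Chebyshev's inequality requires.
\<close>
lemma exp_coeff_nonneg_antimono:
  fixes g w :: "nat \<Rightarrow> real" and c :: real
  assumes g0: "g 0 > 0"
    and g: "\<And>n. g (Suc n) = g n * (1 + g 0 * c / ((real n + 1) * (real n + 1 + c)))"
    and w0: "w 0 = 1"
    and w: "\<And>n. real (Suc n) * w (Suc n) = \<theta> * (\<Sum>k\<le>n. g k * w (n - k))"
    and c: "c > 0" and \<theta>: "\<theta> \<ge> 0"
    and g0_le: "2 * g 0 * (c + 1) \<le> 1"
    and \<theta>_le: "\<theta> * g 0 \<le> (c + 1) / (2 * c + 1)"
  shows "0 \<le> w n \<and> w (Suc n) \<le> w n"
proof -
  have g_pos: "g n > 0" for n
    by (induction n) (use g0 c in \<open>auto simp: g intro!: mult_pos_pos add_pos_nonneg\<close>)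
  have g_mono: "g i \<le> g j" if "i \<le> j" for i j
  proof -
    have "g n \<le> g (Suc n)" for n
      using g_pos[of n] g0 c by (simp add: g algebra_simps)
    then show ?thesis using that by (rule lift_Suc_mono_le)
  qed
  have w_nonneg: "w n \<ge> 0" for n
  proof (induction n rule: less_induct)
    case (less n)
    show ?case
    proof (cases n)
      case (Suc m)
      have "\<theta> * (\<Sum>k\<le>m. g k * w (m - k)) \<ge> 0"
        using less Suc \<theta> g_pos by (intro mult_nonneg_nonneg sum_nonneg) (auto simp: less_imp_le)
      then have "real (Suc m) * w (Suc m) \<ge> 0" using w by simp
      then show ?thesis using Suc by (simp add: zero_le_mult_iff)
    qed (simp add: w0)
  qed
  have "w (Suc n) \<le> w n"
  proof (induction n rule: less_induct)
    case (less n)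
    show ?case
    proof (cases n)
      case 0
      have "(c + 1) / (2 * c + 1) \<le> 1" using c by simp
      then show ?thesis using w[of 0] w0 \<theta>_le 0 by simp
    next
      case (Suc m)
      have w_anti: "w j \<le> w i" if "i \<le> j" "j \<le> n" for i j
        using that
      proof (induction j rule: dec_induct)
        case (step k)
        then show ?case using less[of k] by linarith
      qed simp
      have alg: "A / B * u + v * u + x * y * (u * (2 * A / B)) =
          u * (v + (A + y * (2 * x * A)) / B)" for A B u v x y :: real
        by (simp add: algebra_simps add_divide_distrib)
      define t where "t k = g k * w (m - k)" for k
      define e where "e k = 1 / ((real k + 1) * (real k + 1 + c))" for k
      have t_mono: "t i \<le> t j" if "i \<le> j" "j < n" for i j
        unfolding t_def using that Suc g_pos
        by (intro mult_mono g_mono w_anti w_nonneg) (auto simp: less_imp_le)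
      have e_anti: "e j \<le> e i" if "i \<le> j" "j < n" for i j
        unfolding e_def using that c
        by (intro divide_left_mono mult_mono mult_pos_pos) auto
      \<comment> \<open>The recurrence for \<open>w\<^sub>n\<close> itself: it turns the sum of \<open>t\<close> back into \<open>w\<^sub>n\<close>.\<close>
      have t_sum: "\<theta> * (\<Sum>k=0..<n. t k) = real n * w n"
        using w[of m] Suc by (simp add: t_def atLeast0LessThan lessThan_Suc_atMost)
      have "real n * (\<Sum>k=0..<n. t k * e k) \<le> (\<Sum>k=0..<n. t k) * (\<Sum>k=0..<n. e k)"
        using Chebyshev_sum_upper[of n t e] t_mono e_anti by simp
      also have "\<dots> \<le> (\<Sum>k=0..<n. t k) * (2 * (c + 1) / (2 * c + 1))"
        using sum_inverse_quadratic_le[OF c, of n] g_pos w_nonneg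
        by (intro mult_left_mono sum_nonneg) (auto simp: e_def t_def less_imp_le)
      finally have "\<theta> * (real n * (\<Sum>k=0..<n. t k * e k))
          \<le> \<theta> * ((\<Sum>k=0..<n. t k) * (2 * (c + 1) / (2 * c + 1)))"
        using \<theta> by (rule mult_left_mono)
      also have "\<dots> = real n * (w n * (2 * (c + 1) / (2 * c + 1)))"
        using t_sum by (metis mult.assoc)
      finally have "real n * (\<theta> * (\<Sum>k=0..<n. t k * e k))
          \<le> real n * (w n * (2 * (c + 1) / (2 * c + 1)))"
        by (simp only: mult_ac)
      then have te: "\<theta> * (\<Sum>k=0..<n. t k * e k) \<le> w n * (2 * (c + 1) / (2 * c + 1))"
        using Suc by (subst (asm) mult_le_cancel_left_pos) auto
      have "(\<Sum>k\<le>n. g k * w (n - k)) = g 0 * w n + (\<Sum>k\<le>m. g (Suc k) * w (m - k))"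
        unfolding Suc by (subst sum.atMost_Suc_shift) simp
      also have "(\<Sum>k\<le>m. g (Suc k) * w (m - k)) = (\<Sum>k=0..<n. t k + g 0 * c * (t k * e k))"
        unfolding Suc atLeast0LessThan lessThan_Suc_atMost
        by (intro sum.cong refl) (simp add: g t_def e_def algebra_simps)
      also have "\<dots> = (\<Sum>k=0..<n. t k) + g 0 * c * (\<Sum>k=0..<n. t k * e k)"
        by (simp add: sum.distrib sum_distrib_left)
      finally have "real (Suc n) * w (Suc n) = \<theta> * g 0 * w n + \<theta> * (\<Sum>k=0..<n. t k)
          + g 0 * c * (\<theta> * (\<Sum>k=0..<n. t k * e k))"
        unfolding w by (simp add: algebra_simps)
      also have "\<dots> \<le> (c + 1) / (2 * c + 1) * w n + real n * w n
          + g 0 * c * (w n * (2 * (c + 1) / (2 * c + 1)))"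
        unfolding t_sum using te \<theta>_le w_nonneg g0 c
        by (intro add_mono mult_left_mono mult_right_mono) auto
      also have "\<dots> = w n * (real n + (c + 1 + c * (2 * g 0 * (c + 1))) / (2 * c + 1))"
        by (rule alg)
      \<comment> \<open>The remaining fraction becomes exactly \<open>1\<close> once \<open>2 g\<^sub>0 (c + 1)\<close> is replaced by \<open>1\<close>.\<close>
      also have "\<dots> \<le> w n * (real n + (c + 1 + c * 1) / (2 * c + 1))"
        using g0_le c w_nonneg
        by (intro mult_left_mono add_mono divide_right_mono) auto
      also have "(c + 1 + c * 1) / (2 * c + 1) = 1" using c by simp
      finally have "real (Suc n) * w (Suc n) \<le> real (Suc n) * w n"
        by (simp only: of_nat_Suc mult_ac add_ac)
      then show ?thesis by (rule mult_left_le_imp_le) (rule of_nat_0_less_iff[THEN iffD2, OF zero_less_Suc])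
    qed
  qed
  then show ?thesis using w_nonneg by blast
qed

abbreviation hypergeo_deriv_nth :: "real \<Rightarrow> real \<Rightarrow> real \<Rightarrow> nat \<Rightarrow> real" where
  "hypergeo_deriv_nth a b c \<equiv> fps_nth (fps_deriv (hypergeo_fps a b c))"

context
  fixes a b c :: real
  assumes pos: "a > 0" "b > 0" "c > 0"
begin

lemma hypergeo_fps_nth_0: "fps_nth (hypergeo_fps a b c) 0 = 1"
  by (simp add: hypergeo_fps_def)

lemma hypergeo_fps_nth_pos: "fps_nth (hypergeo_fps a b c) n > 0"
  using pos by (simp add: hypergeo_fps_def pochhammer_pos)

lemma hypergeo_fps_nth_Suc:
  "fps_nth (hypergeo_fps a b c) (Suc n) =
     fps_nth (hypergeo_fps a b c) n * ((a + n) * (b + n) / ((c + n) * (n + 1)))"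
  by (simp add: hypergeo_fps_def pochhammer_Suc field_simps)

lemma hypergeo_fps_conv_radius: "fps_conv_radius (hypergeo_fps a b c) = 1"
  unfolding fps_conv_radius_def
proof (rule conv_radius_ratio_limit_ereal_nonzero)
  let ?f = "fps_nth (hypergeo_fps a b c)"
  have "norm (?f n) / norm (?f (Suc n)) = (c + n) * (n + 1) / ((a + n) * (b + n))" for n
    using hypergeo_fps_nth_pos[of n] pos
    by (simp add: hypergeo_fps_nth_Suc abs_mult abs_of_pos add_pos_nonneg)
  moreover have "(\<lambda>n. (c + real n) * (n + 1) / ((a + n) * (b + n))) \<longlonglongrightarrow> 1"
    using pos by real_asymp
  ultimately show "(\<lambda>n. ereal (norm (?f n) / norm (?f (Suc n)))) \<longlonglongrightarrow> 1"
    by (simp add: one_ereal_def)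
qed simp

lemma hypergeo_deriv_nth_0: "hypergeo_deriv_nth a b c 0 = a * b / c"
  by (simp add: hypergeo_fps_def)

lemma hypergeo_deriv_nth_pos: "hypergeo_deriv_nth a b c n > 0"
  using hypergeo_fps_nth_pos[of "Suc n"] by (simp del: of_nat_Suc)

lemma hypergeo_deriv_nth_Suc:
  "hypergeo_deriv_nth a b c (Suc n) = hypergeo_deriv_nth a b c n * ((a + n + 1) * (b + n + 1) / ((n + 1) * (n + 1 + c)))"
proof -
  let ?f = "fps_nth (hypergeo_fps a b c) (Suc n)" and ?A = "(a + n + 1) * (b + n + 1)"
  have "hypergeo_deriv_nth a b c (Suc n) = (n + 2) * (?f * (?A / ((n + 1 + c) * (n + 2))))"
    using hypergeo_fps_nth_Suc[of "Suc n"] by (simp add: add_ac)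
  also have "\<dots> = ?f * (?A / (n + 1 + c))" by simp
  also have "\<dots> = (n + 1) * ?f * (?A / ((n + 1) * (n + 1 + c)))"
  proof -
    have "u * (v / y) = x * u * (v / (x * y))" if "x \<noteq> 0" for u v x y :: real
      using that by simp
    then show ?thesis by simp
  qed
  also have "(n + 1) * ?f = hypergeo_deriv_nth a b c n" by simp
  finally show ?thesis by (simp only: of_nat_add of_nat_1)
qed

text \<open>
  The ratio of consecutive coefficients of \<open>F'\<close> is at least \<open>1\<close>, because
  \<open>(a + n + 1) (b + n + 1)\<close> exceeds \<open>(n + 1) (n + 1 + c)\<close> by \<open>a b + (a + b - c) (n + 1)\<close>.
\<close>
lemma hypergeo_deriv_nth_ge:
  assumes "c \<le> a + b"
  shows "hypergeo_deriv_nth a b c n \<ge> a * b / c"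
proof (induction n)
  case (Suc n)
  have "(real n + 1) * (real n + 1 + c) + (a * b + (a + b - c) * (real n + 1)) =
      (a + n + 1) * (b + n + 1)"
    by (simp add: algebra_simps)
  moreover have "a * b + (a + b - c) * (real n + 1) \<ge> 0" using assms pos by simp
  ultimately have "(real n + 1) * (real n + 1 + c) \<le> (a + n + 1) * (b + n + 1)"
    by linarith
  moreover have "(real n + 1) * (real n + 1 + c) > 0" using pos by simp
  ultimately have "(a + n + 1) * (b + n + 1) / ((real n + 1) * (real n + 1 + c)) \<ge> 1"
    by (simp only: le_divide_eq_1_pos)
  then have "hypergeo_deriv_nth a b c n * 1 \<le> hypergeo_deriv_nth a b c (Suc n)"
    unfolding hypergeo_deriv_nth_Suc
    by (rule mult_left_mono) (rule less_imp_le[OF hypergeo_deriv_nth_pos])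
  with Suc show ?case by linarith
qed (simp only: hypergeo_deriv_nth_0)

lemma hypergeo_deriv_has_derivative:
  assumes "\<bar>x\<bar> < 1"
  shows "(gauss_hypergeo a b c has_real_derivative
     eval_fps (fps_deriv (hypergeo_fps a b c)) x) (at x)"
proof -
  have "gauss_hypergeo a b c = eval_fps (hypergeo_fps a b c)"
    by (simp add: eval_hypergeo_fps fun_eq_iff)
  then show ?thesis
    using assms hypergeo_fps_conv_radius
    by (auto intro!: has_field_derivative_eval_fps less_fps_conv_radius)
qed

lemma hypergeo_deriv_conv_radius: "fps_conv_radius (fps_deriv (hypergeo_fps a b c)) \<ge> 1"
  using fps_conv_radius_deriv[of "hypergeo_fps a b c"] by (simp only: hypergeo_fps_conv_radius)

end

section \<open>The function \<open>(1 - x)\<^sup>p exp F(a, b; c; x)\<close>\<close>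

lemma G_fun_has_derivative:
  assumes "a > 0" "b > 0" "c > 0" "x \<in> {0<..<1}"
  shows "(G_fun a b c p has_real_derivative
     (eval_fps (fps_deriv (hypergeo_fps a b c)) x - p / (1 - x)) * G_fun a b c p x) (at x)"
proof -
  have x: "1 - x > 0" "\<bar>x\<bar> < 1" using assms(4) by auto
  have "((\<lambda>x. (1 - x) powr p) has_real_derivative p * (1 - x) powr (p - 1) * - 1) (at x)"
    by (rule DERIV_chain2[where g = "\<lambda>x. 1 - x", OF has_real_derivative_powr[OF x(1)]])
       (auto intro!: derivative_eq_intros)
  from DERIV_mult[OF this DERIV_fun_exp[OF hypergeo_deriv_has_derivative[OF assms(1-3) x(2)]]]
  show ?thesis
    unfolding G_fun_def[abs_def]
    by (rule DERIV_cong) (use x in \<open>simp add: powr_diff algebra_simps\<close>)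
qed

lemma G_fun_absolutely_monotonic:
  assumes "a > 0" "b > 0" "c > 0" "c \<le> a + b" "p \<le> a * b / c"
  shows "absolutely_monotonic_on {0<..<1} (G_fun a b c p)"
proof (rule absolutely_monotonic_on_log_derivative)
  let ?F' = "fps_deriv (hypergeo_fps a b c)" and ?P = "Abs_fps (\<lambda>_. p)"
  let ?h = "\<lambda>x. eval_fps ?F' x - p / (1 - x)"
  have rP: "fps_conv_radius ?P \<ge> 1"
    by (rule fps_conv_radius_ge_1I[of _ "\<bar>p\<bar>"]) simp
  have rF: "fps_conv_radius ?F' \<ge> 1"
    using assms(1-3) by (rule hypergeo_deriv_conv_radius)
  have "absolutely_monotonic_on {0<..<1} (eval_fps (?F' - ?P))"
  proof (rule absolutely_monotonic_on_eval_fps)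
    show "fps_conv_radius (?F' - ?P) \<ge> 1"
      using rF rP by (rule fps_conv_radius_ge_1_arith)
    show "fps_nth (?F' - ?P) n \<ge> 0" for n
      using hypergeo_deriv_nth_ge[OF assms(1-4), of n] assms(5) by simp
  qed
  then show "absolutely_monotonic_on {0<..<1} ?h"
    by (rule absolutely_monotonic_on_cong)
       (simp add: fps_conv_radius_ge_1_arith rF rP eval_fps_geometric)
  show "(G_fun a b c p has_real_derivative ?h x * G_fun a b c p x) (at x within {0<..<1})"
    if "x \<in> {0<..<1}" for x
    using G_fun_has_derivative[OF assms(1-3) that] has_field_derivative_at_within by blast
qed (simp add: G_fun_def)

lemma deriv_absolutely_monotonic:
  assumes "open I" "absolutely_monotonic_on I f"
  shows "absolutely_monotonic_on I (deriv f)"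
proof -
  obtain f' where f': "absolutely_monotonic_on I f'"
    "\<forall>x\<in>I. (f has_real_derivative f' x) (at x within I)"
    using assms(2) by (rule absolutely_monotonic_on_derivative)
  show ?thesis
    using f'(1)
  proof (rule absolutely_monotonic_on_cong)
    show "f' x = deriv f x" if "x \<in> I" for x
      using f'(2) that at_within_open[OF that assms(1)] DERIV_imp_deriv by metis
  qed
qed

text \<open>
  The bound is the limit of \<open>G' / G \<ge> 0\<close> at \<open>0\<close>, since \<open>G' / G\<close> extends continuously to \<open>0\<close>
  with value \<open>a b / c - p\<close>.
\<close>
lemma G_fun_deriv_nonneg_imp:
  assumes "a > 0" "b > 0" "c > 0"
    and nonneg: "\<And>x. x \<in> {0<..<1} \<Longrightarrow> deriv (G_fun a b c p) x \<ge> 0"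
  shows "p \<le> a * b / c"
proof -
  let ?F' = "fps_deriv (hypergeo_fps a b c)"
  let ?h = "\<lambda>x. eval_fps ?F' x - p / (1 - x)"
  have h: "?h x \<ge> 0" if "x \<in> {0<..<1}" for x
  proof -
    have "?h x * G_fun a b c p x \<ge> 0"
      using nonneg[OF that] DERIV_imp_deriv[OF G_fun_has_derivative[OF assms(1-3) that]] by metis
    moreover have "G_fun a b c p x > 0" using that by (simp add: G_fun_def)
    ultimately show ?thesis by (simp add: zero_le_mult_iff)
  qed
  have "ereal (norm (0 :: real)) < fps_conv_radius ?F'"
    by (rule less_fps_conv_radius[OF hypergeo_deriv_conv_radius[OF assms(1-3)]]) simp
  then have "isCont (eval_fps ?F') 0"
    by (rule DERIV_isCont[OF has_field_derivative_eval_fps])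
  then have "isCont ?h 0"
    by (rule isCont_diff) (intro continuous_intros, simp)
  then have "(?h \<longlongrightarrow> ?h 0) (at_right 0)"
    by (simp add: isCont_def filterlim_at_split)
  moreover have "eventually (\<lambda>x. ?h x \<ge> 0) (at_right 0)"
    using eventually_at_right_real[of 0 1] by (rule eventually_mono) (use h in auto)
  ultimately have "?h 0 \<ge> 0"
    by (intro tendsto_lowerbound) auto
  then show ?thesis
    using hypergeo_deriv_nth_0[OF assms(1-3)] by (simp add: eval_fps_at_0)
qed

text \<open>
  The two hypotheses on the parameters are what \<open>exp_coeff_nonneg_antimono\<close> asks for with
  \<open>\<theta> = 1 / p\<close> and \<open>g\<^sub>0 = a b / c\<close>: the first is \<open>2 g\<^sub>0 (c + 1) \<le> 1\<close>, and the lower bound on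
  \<open>p\<close> is \<open>\<theta> g\<^sub>0 \<le> (c + 1) / (2 c + 1)\<close>.
\<close>
lemma neg_deriv_G_fun_absolutely_monotonic:
  assumes pos: "a > 0" "b > 0" "c > 0" and c: "c = a + b"
    and ab: "c \<ge> 2 * a * b * (c + 1)"
    and p: "a * b * (2 * c + 1) / (c * (c + 1)) \<le> p" "p \<le> 1"
  shows "absolutely_monotonic_on {0<..<1} (\<lambda>x. - deriv (G_fun a b c p) x)"
proof -
  define F where "F = hypergeo_fps a b c"
  define g where "g = fps_nth (fps_deriv F)"
  define W where "W = fps_compose (fps_exp (1 / p)) (F - 1)"
  define w where "w = fps_nth W"
  have p_pos: "p > 0"
    using p(1) pos by (intro less_le_trans[OF _ p(1)]) (auto intro!: divide_pos_pos mult_pos_pos add_pos_pos)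
  have F0: "fps_nth F 0 = 1"
    by (simp add: F_def hypergeo_fps_def)
  have W0: "fps_nth W 0 = 1" by (simp add: W_def)
  have W': "fps_deriv W = fps_const (1 / p) * fps_deriv F * W"
    using fps_compose_deriv[of "F - 1" "fps_exp (1 / p)"] F0
    by (simp add: W_def fps_compose_mult_distrib mult_ac)
  have g0: "g 0 = a * b / c"
    unfolding g_def F_def by (rule hypergeo_deriv_nth_0[OF pos])
  have w: "0 \<le> w n \<and> w (Suc n) \<le> w n" for n
  proof (rule exp_coeff_nonneg_antimono[of g c w "1 / p"])
    show "g 0 > 0" using g0 pos by simp
    show "g (Suc n) = g n * (1 + g 0 * c / ((real n + 1) * (real n + 1 + c)))" for n
    proof -
      have "g 0 * c = a * b" using g0 pos by simp
      then have eq: "(a + n + 1) * (b + n + 1) = (real n + 1) * (real n + 1 + c) + g 0 * c"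
        by (simp add: c algebra_simps)
      have nz: "(real n + 1) * (real n + 1 + c) \<noteq> 0" using pos by simp
      have "(a + n + 1) * (b + n + 1) / ((real n + 1) * (real n + 1 + c))
          = 1 + g 0 * c / ((real n + 1) * (real n + 1 + c))"
        by (simp only: eq add_divide_distrib divide_self[OF nz])
      then show "g (Suc n) = g n * (1 + g 0 * c / ((real n + 1) * (real n + 1 + c)))"
        using hypergeo_deriv_nth_Suc[OF pos, of n] unfolding g_def F_def by (simp only:)
    qed
    show "real (Suc n) * w (Suc n) = 1 / p * (\<Sum>k\<le>n. g k * w (n - k))" for n
    proof -
      have "fps_nth (fps_deriv W) n = 1 / p * fps_nth (fps_deriv F * W) n"
        by (simp only: W' mult.assoc fps_mult_left_const_nth)
      then show ?thesis
        by (simp only: w_def g_def fps_mult_nth atLeast0AtMost fps_deriv_nth Suc_eq_plus1)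
    qed
    show "2 * g 0 * (c + 1) \<le> 1"
      using ab pos unfolding g0 by (simp add: field_simps)
    have "g 0 * (2 * c + 1) \<le> p * (c + 1)"
    proof -
      have "a * b * (2 * c + 1) \<le> p * (c * (c + 1))"
        using p(1) pos by (subst (asm) pos_divide_le_eq) auto
      then show ?thesis using pos unfolding g0 by (simp add: pos_divide_le_eq mult_ac)
    qed
    then show "1 / p * g 0 \<le> (c + 1) / (2 * c + 1)"
      using p_pos pos by (simp add: field_simps)
  qed (use W0 pos p_pos in \<open>auto simp: w_def\<close>)
  \<comment> \<open>Monotonicity of \<open>w\<close> also supplies the convergence of \<open>W\<close> on the unit disc.\<close>
  have w_le_1: "w n \<le> 1" for n
    using w lift_Suc_antimono_le[of w 0 n] W0 by (simp add: w_def)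
  have rW: "fps_conv_radius W \<ge> 1"
    by (rule fps_conv_radius_ge_1I[of _ 1]) (use w w_le_1 in \<open>simp add: w_def\<close>)
  have rF: "fps_conv_radius F \<ge> 1"
    using hypergeo_fps_conv_radius[OF pos] by (simp add: F_def)
  have W_eval: "eval_fps W x = exp (1 / p * (gauss_hypergeo a b c x - 1))" if "\<bar>x\<bar> < 1" for x
    using eval_fps_exp_solution[OF W' W0 rW rF that] F0 by (simp add: F_def eval_hypergeo_fps)

  define V where "V = (1 - fps_X) * W"
  have rX: "fps_conv_radius (1 - fps_X :: real fps) \<ge> 1"
    by (rule fps_conv_radius_ge_1_arith) auto
  have rV: "fps_conv_radius V \<ge> 1"
    unfolding V_def using rX rW by (rule fps_conv_radius_ge_1_arith)
  have V_eval: "eval_fps V x = (1 - x) * eval_fps W x" if "\<bar>x\<bar> < 1" for x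
    using that rX rW by (simp add: V_def fps_conv_radius_ge_1_arith)
  define K where "K = eval_fps (- fps_deriv V)"
  have rV': "fps_conv_radius (fps_deriv V) \<ge> 1"
    using order_trans[OF rV fps_conv_radius_deriv] .
  have K: "absolutely_monotonic_on {0<..<1} K"
    unfolding K_def
  proof (rule absolutely_monotonic_on_eval_fps)
    show "fps_conv_radius (- fps_deriv V) \<ge> 1" using rV' by simp
    have "fps_nth V (Suc n) = w (Suc n) - w n" for n
      by (simp add: V_def w_def left_diff_distrib)
    then show "fps_nth (- fps_deriv V) n \<ge> 0" for n
      using w[of n] by (simp add: mult_nonneg_nonpos)
  qed
  have V': "(eval_fps V has_real_derivative - K x) (at x)" if "x \<in> {0<..<1}" for x
  proof -
    have x: "\<bar>x\<bar> < 1" using that by auto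
    show ?thesis
      using has_field_derivative_eval_fps[OF less_fps_conv_radius[OF rV x], of UNIV]
      by (simp only: K_def eval_fps_minus[OF less_fps_conv_radius[OF rV' x]] minus_minus)
  qed
  have V_pos: "eval_fps V x > 0" if "x \<in> {0<..<1}" for x
    using that by (simp add: V_eval W_eval)
  have V_powr: "G_fun a b c p x = exp 1 * eval_fps V x powr p" if "x \<in> {0<..<1}" for x
  proof -
    have "eval_fps V x powr p = (1 - x) powr p * exp (gauss_hypergeo a b c x - 1)"
      using that p_pos by (simp add: V_eval W_eval powr_mult exp_powr_real)
    then show ?thesis by (simp add: G_fun_def exp_diff)
  qed
  have neg: "- deriv (G_fun a b c p) x = exp 1 * (p * K x * eval_fps V x powr (p - 1))"
    if x: "x \<in> {0<..<1}" for x
  proof -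
    have "((\<lambda>x. exp 1 * eval_fps V x powr p) has_real_derivative
        exp 1 * (p * eval_fps V x powr (p - 1) * - K x)) (at x)"
      by (intro DERIV_cmult DERIV_chain2[OF has_real_derivative_powr] V' V_pos x)
    then have "(G_fun a b c p has_real_derivative
        exp 1 * (p * eval_fps V x powr (p - 1) * - K x)) (at x)"
      by (rule has_field_derivative_transform_within_open[of _ _ _ "{0<..<1}"])
         (use x in \<open>auto simp: V_powr\<close>)
    then show ?thesis
      by (simp add: DERIV_imp_deriv)
  qed
  have "absolutely_monotonic_on {0<..<1} (\<lambda>x. p * K x * eval_fps V x powr (p - 1))"
    using K V_pos V' p(2) p_pos
    by (intro absolutely_monotonic_on_neg_derivative_powr) (auto intro: has_field_derivative_at_within)
  then have "absolutely_monotonic_on {0<..<1}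
      (\<lambda>x. exp 1 * (p * K x * eval_fps V x powr (p - 1)))"
    by (intro absolutely_monotonic_on_mult[OF absolutely_monotonic_on_const]) auto
  then show ?thesis
    by (rule absolutely_monotonic_on_cong) (simp add: neg)
qed

theorem theorem3:
  fixes a b c p :: real
  assumes "a > 0" and "b > 0" and "c > 0" and "c \<le> a + b"
  shows "(absolutely_monotonic_on {0<..<1} (G_fun a b c p) \<and>
          absolutely_monotonic_on {0<..<1} (deriv (G_fun a b c p))
            \<longleftrightarrow> p \<le> a * b / c) \<and>
         (c = a + b \<and> a + b \<ge> 2 * a * b * (a + b + 1) \<and>
          a * b * (2 * a + 2 * b + 1) / ((a + b) * (a + b + 1)) \<le> p \<and> p \<le> 1
            \<longrightarrow> absolutely_monotonic_on {0<..<1} (\<lambda>x. - deriv (G_fun a b c p) x))"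
proof (intro conjI iffI impI)
  assume "absolutely_monotonic_on {0<..<1} (G_fun a b c p) \<and>
          absolutely_monotonic_on {0<..<1} (deriv (G_fun a b c p))"
  then show "p \<le> a * b / c"
    using G_fun_deriv_nonneg_imp[OF assms(1-3)] absolutely_monotonic_on_nonneg by blast
next
  assume "p \<le> a * b / c"
  with assms show "absolutely_monotonic_on {0<..<1} (G_fun a b c p)"
    by (intro G_fun_absolutely_monotonic)
  then show "absolutely_monotonic_on {0<..<1} (deriv (G_fun a b c p))"
    by (intro deriv_absolutely_monotonic) auto
next
  assume "c = a + b \<and> a + b \<ge> 2 * a * b * (a + b + 1) \<and>
          a * b * (2 * a + 2 * b + 1) / ((a + b) * (a + b + 1)) \<le> p \<and> p \<le> 1"
  then show "absolutely_monotonic_on {0<..<1} (\<lambda>x. - deriv (G_fun a b c p) x)"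
    by (intro neg_deriv_G_fun_absolutely_monotonic[OF assms(1-3)]) (auto simp: algebra_simps)
qed

end
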